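(* Let $V_1,\dots,V_k$ be finite-dimensional representations of a group $G$. One can identify multi-homogeneous invariant forms with multi-symmetric invariant multilinear maps.
   Context: Representations are linear representations on real vector spaces. A multi-homogeneous form of multi-degree $(d_1,\dots,d_k)$ is a real polynomial $f(v_1,\dots,v_k)$ in vectors $v_j\in V_j$ that is homogeneous of degree $d_j$ in $v_j$ for each $j$. A multilinear map here is a multilinear form $F\colon V_1^{d_1}\times\dots\times V_k^{d_k}\to\mathbb{R}$; it is multi-symmetric if, for each $j$, it is symmetric in its $d_j$ arguments from $V_j$. The group $G$ acts diagonally on products of representations and acts on functions by $(g\ast f)(x)=f(g^{-1}\ast x)$; invariant means fixed by all $g\in G$. Background for the word "identify": every multi-homogeneous polynomial $f$ of multi-degree $(d_1,\dots,d_k)$ is uniquely associated with a multi-symmetric multilinear form on $V_1^{d_1}\times\dots\times V_k^{d_k}$, called its polarization, from which $f$ is recovered by evaluation on the multi-diagonal (all $d_j$ arguments from $V_j$ set equal to $v_j$, for each $j$), a process called restitution; polarization and restitution commute with the action of $G$, so invariant multi-homogeneous polynomials are sent to invariant multilinear forms. *)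

theory Defs
  imports Complex_Main "HOL-Library.FuncSet" "HOL-Combinatorics.Permutations"
    "HOL-Algebra.Group_Action"
begin

text \<open>Vector spaces of varying dimension are modelled as subspaces of an arbitrary ambient real
  vector space; any family of vector spaces embeds into its direct sum. Functions on a set \<open>X\<close>
  are extensional (equal to \<^const>\<open>undefined\<close> outside \<open>X\<close>), so that equality of functions is
  equality on \<open>X\<close>.\<close>

definition linear_on :: "'a::real_vector set \<Rightarrow> ('a \<Rightarrow> 'b::real_vector) \<Rightarrow> bool" where
  "linear_on V f \<longleftrightarrow>
     (\<forall>x\<in>V. \<forall>y\<in>V. f (x + y) = f x + f y) \<and> (\<forall>c. \<forall>x\<in>V. f (c *\<^sub>R x) = c *\<^sub>R f x)"

definition fin_dim_subspace :: "'a::real_vector set \<Rightarrow> bool" where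
  "fin_dim_subspace V \<longleftrightarrow> subspace V \<and> (\<exists>B. finite B \<and> span B = V)"

definition fin_dim_rep ::
  "('g, 'm) monoid_scheme \<Rightarrow> 'a::real_vector set \<Rightarrow> ('g \<Rightarrow> 'a \<Rightarrow> 'a) \<Rightarrow> bool" where
  "fin_dim_rep G V \<rho> \<longleftrightarrow>
     fin_dim_subspace V \<and> group_action G V \<rho> \<and> (\<forall>g\<in>carrier G. linear_on V (\<rho> g))"


definition diag_act :: "'i set \<Rightarrow> ('i \<Rightarrow> 'g \<Rightarrow> 'a \<Rightarrow> 'a) \<Rightarrow> 'g \<Rightarrow> ('i \<Rightarrow> 'a) \<Rightarrow> ('i \<Rightarrow> 'a)" where
  "diag_act J \<rho> g x = (\<lambda>j\<in>J. \<rho> j g (x j))"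

definition fun_act ::
  "('g, 'm) monoid_scheme \<Rightarrow> 'x set \<Rightarrow> ('g \<Rightarrow> 'x \<Rightarrow> 'x) \<Rightarrow> 'g \<Rightarrow> ('x \<Rightarrow> real) \<Rightarrow> ('x \<Rightarrow> real)" where
  "fun_act G X act g f = (\<lambda>x\<in>X. f (act (inv\<^bsub>G\<^esub> g) x))"

definition invariant ::
  "('g, 'm) monoid_scheme \<Rightarrow> 'x set \<Rightarrow> ('g \<Rightarrow> 'x \<Rightarrow> 'x) \<Rightarrow> ('x \<Rightarrow> real) \<Rightarrow> bool" where
  "invariant G X act f \<longleftrightarrow> (\<forall>g\<in>carrier G. fun_act G X act g f = f)"

definition lin_comb :: "'x set \<Rightarrow> real \<Rightarrow> ('x \<Rightarrow> real) \<Rightarrow> real \<Rightarrow> ('x \<Rightarrow> real) \<Rightarrow> ('x \<Rightarrow> real)" where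
  "lin_comb X a f b g = (\<lambda>x\<in>X. a * f x + b * g x)"


definition vecs :: "nat \<Rightarrow> (nat \<Rightarrow> 'a set) \<Rightarrow> (nat \<Rightarrow> 'a) set" where
  "vecs k V = (\<Pi>\<^sub>E j\<in>{1..k}. V j)"

text \<open>The real algebra of functions on \<open>V\<^sub>1 \<times> \<dots> \<times> V\<^sub>k\<close> generated by the linear functionals of the
  factors, i.e. polynomials in linear coordinates. As the reals are infinite, polynomials and
  polynomial functions coincide.\<close>

inductive_set polynomials :: "nat \<Rightarrow> (nat \<Rightarrow> 'a::real_vector set) \<Rightarrow> ((nat \<Rightarrow> 'a) \<Rightarrow> real) set"
  for k V where
  const: "(\<lambda>v\<in>vecs k V. c) \<in> polynomials k V"
| coord: "j \<in> {1..k} \<Longrightarrow> linear_on (V j) \<phi> \<Longrightarrow> (\<lambda>v\<in>vecs k V. \<phi> (v j)) \<in> polynomials k V"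
| add: "p \<in> polynomials k V \<Longrightarrow> q \<in> polynomials k V \<Longrightarrow> (\<lambda>v\<in>vecs k V. p v + q v) \<in> polynomials k V"
| mult: "p \<in> polynomials k V \<Longrightarrow> q \<in> polynomials k V \<Longrightarrow> (\<lambda>v\<in>vecs k V. p v * q v) \<in> polynomials k V"

definition multi_homogeneous_forms ::
  "nat \<Rightarrow> (nat \<Rightarrow> 'a::real_vector set) \<Rightarrow> (nat \<Rightarrow> nat) \<Rightarrow> ((nat \<Rightarrow> 'a) \<Rightarrow> real) set" where
  "multi_homogeneous_forms k V d =
     {f \<in> polynomials k V.
        \<forall>j\<in>{1..k}. \<forall>t. \<forall>v\<in>vecs k V. f (v(j := t *\<^sub>R v j)) = t ^ d j * f v}"

definition invariant_forms ::
  "('g, 'm) monoid_scheme \<Rightarrow> nat \<Rightarrow> (nat \<Rightarrow> 'a::real_vector set) \<Rightarrow> (nat \<Rightarrow> 'g \<Rightarrow> 'a \<Rightarrow> 'a) \<Rightarrow>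
     (nat \<Rightarrow> nat) \<Rightarrow> ((nat \<Rightarrow> 'a) \<Rightarrow> real) set" where
  "invariant_forms G k V \<rho> d =
     {f \<in> multi_homogeneous_forms k V d. invariant G (vecs k V) (diag_act {1..k} \<rho>) f}"


text \<open>An element of \<open>V\<^sub>1\<^bsup>d\<^sub>1\<^esup> \<times> \<dots> \<times> V\<^sub>k\<^bsup>d\<^sub>k\<^esup>\<close> is a family indexed by the slots \<open>(j, i)\<close>, the \<open>i\<close>-th of the
  \<open>d j\<close> arguments from \<open>V j\<close>.\<close>

definition slots :: "nat \<Rightarrow> (nat \<Rightarrow> nat) \<Rightarrow> (nat \<times> nat) set" where
  "slots k d = (SIGMA j:{1..k}. {1..d j})"

definition args :: "nat \<Rightarrow> (nat \<Rightarrow> 'a set) \<Rightarrow> (nat \<Rightarrow> nat) \<Rightarrow> (nat \<times> nat \<Rightarrow> 'a) set" where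
  "args k V d = (\<Pi>\<^sub>E s\<in>slots k d. V (fst s))"

definition multilinear_maps ::
  "nat \<Rightarrow> (nat \<Rightarrow> 'a::real_vector set) \<Rightarrow> (nat \<Rightarrow> nat) \<Rightarrow> ((nat \<times> nat \<Rightarrow> 'a) \<Rightarrow> real) set" where
  "multilinear_maps k V d =
     {F \<in> extensional (args k V d).
        \<forall>s\<in>slots k d. \<forall>x\<in>args k V d. linear_on (V (fst s)) (\<lambda>a. F (x(s := a)))}"

definition multi_symmetric ::
  "nat \<Rightarrow> (nat \<Rightarrow> 'a set) \<Rightarrow> (nat \<Rightarrow> nat) \<Rightarrow> ((nat \<times> nat \<Rightarrow> 'a) \<Rightarrow> real) \<Rightarrow> bool" where
  "multi_symmetric k V d F \<longleftrightarrow>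
     (\<forall>j\<in>{1..k}. \<forall>\<pi>. \<pi> permutes {1..d j} \<longrightarrow>
        (\<forall>x\<in>args k V d. F (\<lambda>(l, i). if l = j then x (l, \<pi> i) else x (l, i)) = F x))"

definition multi_symmetric_maps ::
  "nat \<Rightarrow> (nat \<Rightarrow> 'a::real_vector set) \<Rightarrow> (nat \<Rightarrow> nat) \<Rightarrow> ((nat \<times> nat \<Rightarrow> 'a) \<Rightarrow> real) set" where
  "multi_symmetric_maps k V d = {F \<in> multilinear_maps k V d. multi_symmetric k V d F}"

definition invariant_multi_symmetric_maps ::
  "('g, 'm) monoid_scheme \<Rightarrow> nat \<Rightarrow> (nat \<Rightarrow> 'a::real_vector set) \<Rightarrow> (nat \<Rightarrow> 'g \<Rightarrow> 'a \<Rightarrow> 'a) \<Rightarrow>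
     (nat \<Rightarrow> nat) \<Rightarrow> ((nat \<times> nat \<Rightarrow> 'a) \<Rightarrow> real) set" where
  "invariant_multi_symmetric_maps G k V \<rho> d =
     {F \<in> multi_symmetric_maps k V d.
        invariant G (args k V d) (diag_act (slots k d) (\<lambda>s. \<rho> (fst s))) F}"


definition restitution ::
  "nat \<Rightarrow> (nat \<Rightarrow> 'a set) \<Rightarrow> (nat \<Rightarrow> nat) \<Rightarrow> ((nat \<times> nat \<Rightarrow> 'a) \<Rightarrow> real) \<Rightarrow> ((nat \<Rightarrow> 'a) \<Rightarrow> real)" where
  "restitution k V d F = (\<lambda>v\<in>vecs k V. F (\<lambda>s\<in>slots k d. v (fst s)))"

text \<open>The description ranges over all multi-symmetric multilinear maps, not only the invariant
  ones: the polarization of a form does not depend on a group.\<close>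

definition polarization ::
  "nat \<Rightarrow> (nat \<Rightarrow> 'a::real_vector set) \<Rightarrow> (nat \<Rightarrow> nat) \<Rightarrow> ((nat \<Rightarrow> 'a) \<Rightarrow> real) \<Rightarrow>
     ((nat \<times> nat \<Rightarrow> 'a) \<Rightarrow> real)" where
  "polarization k V d f = (THE F. F \<in> multi_symmetric_maps k V d \<and> restitution k V d F = f)"

end

theory Submission
  imports Defs "HOL-Computational_Algebra.Polynomial"
begin

text \<open>Restitution is a linear bijection from multi-symmetric multilinear maps onto multi-homogeneous
  forms, and it commutes with the action of \<open>G\<close>; so it restricts to a bijection between the invariant
  elements. Injectivity is the polarization identity: expanding \<open>F\<close> at partial sums of its arguments,
  an alternating sum over the sets of slots occurring in these partial sums keeps only the terms in
  which every argument occurs once, and these all equal \<open>F x\<close> by symmetry. For surjectivity, a form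
  is a sum of products of linear functionals; comparing coefficients in \<open>t\<close> under \<open>v\<^sub>j \<mapsto> t v\<^sub>j\<close> leaves
  only products of the right multi-degree. Such a product is the restitution of a multilinear map,
  which is then averaged over the permutations preserving the blocks of slots.\<close>

section \<open>Multilinear expansion\<close>

lemma linear_on_sum:
  assumes "linear_on V f" "subspace V" "finite T" "\<And>t. t \<in> T \<Longrightarrow> y t \<in> V"
  shows "f (\<Sum>t\<in>T. c t *\<^sub>R y t) = (\<Sum>t\<in>T. c t *\<^sub>R f (y t))"
  using assms(3,4)
proof (induction T rule: finite_induct)
  case empty
  have "f (0 *\<^sub>R 0) = 0 *\<^sub>R f 0"
    using assms(1,2) subspace_0 unfolding linear_on_def by blast
  then show ?case by simp
next
  case (insert t T)
  have "(\<Sum>t\<in>T. c t *\<^sub>R y t) \<in> V" "c t *\<^sub>R y t \<in> V"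
    using insert.prems assms(2) by (auto intro!: subspace_sum subspace_scale)
  then show ?case
    using insert assms(1) unfolding linear_on_def by simp
qed

text \<open>On a subspace, \<open>linear_on\<close> sees only values at points of \<open>V\<close>.
  This lets the restriction to \<open>args k V d\<close> be dropped when linearity in a slot is
  checked.\<close>

lemma linear_on_cong:
  assumes "subspace V" "\<And>x. x \<in> V \<Longrightarrow> f x = g x"
  shows "linear_on V f \<longleftrightarrow> linear_on V g"
  using assms by (simp add: linear_on_def subspace_add subspace_scale cong: ball_cong)

lemma linear_on_sum_fun:
  assumes "\<And>i. i \<in> I \<Longrightarrow> linear_on V (f i)"
  shows "linear_on V (\<lambda>x. \<Sum>i\<in>I. f i x)"
  using assms by (simp add: linear_on_def sum.distrib scaleR_sum_right)

lemma linear_on_sum_list: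
  assumes "\<And>i. i \<in> set xs \<Longrightarrow> linear_on V (f i)"
  shows "linear_on V (\<lambda>x. \<Sum>i\<leftarrow>xs. f i x)"
  using assms by (induction xs) (auto simp: linear_on_def algebra_simps)

lemma linear_on_mult:
  assumes "linear_on V f"
  shows "linear_on V (\<lambda>x. c * f x :: real)"
  using assms by (simp add: linear_on_def algebra_simps)

lemma sum_PiE_insert:
  assumes "s \<notin> S"
  shows "sum h (Pi\<^sub>E (insert s S) T) = (\<Sum>g\<in>Pi\<^sub>E S T. \<Sum>t\<in>T s. h (g(s := t)))"
proof -
  have "sum h (Pi\<^sub>E (insert s S) T) = (\<Sum>(t, g)\<in>T s \<times> Pi\<^sub>E S T. h (g(s := t)))"
    unfolding PiE_insert_eq sum.reindex [OF inj_combinator [OF assms]]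
    by (intro sum.cong) auto
  also have "\<dots> = (\<Sum>t\<in>T s. \<Sum>g\<in>Pi\<^sub>E S T. h (g(s := t)))"
    by (rule sum.cartesian_product [symmetric])
  finally show ?thesis
    using sum.swap by simp
qed

text \<open>Expanding the product of \<open>- 1 + 1\<close> over \<open>A\<close> gives one term per
  subset; the product vanishes unless it is empty.\<close>

lemma sum_alternating_Pow:
  assumes "finite A"
  shows "(\<Sum>C\<in>Pow A. (- 1) ^ card C :: real) = of_bool (A = {})"
proof -
  have "(\<Sum>C\<in>Pow A. (- 1) ^ card C :: real) = (\<Sum>C\<in>Pow A. (\<Prod>x\<in>C. - 1) * (\<Prod>x\<in>A - C. 1))"
    by simp
  also have "\<dots> = (\<Prod>x\<in>A. - 1 + 1)"
    using prod_add [OF assms, of "\<lambda>_. - 1 :: real" "\<lambda>_. 1"] by simp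
  finally show ?thesis using assms by (auto simp: power_0_left)
qed

text \<open>Moebius inversion on subsets: the supersets \<open>S\<close> of \<open>R\<close> inside
  \<open>A\<close> correspond to their complements, which run through all subsets of
  \<open>A - R\<close>.\<close>

lemma sum_alternating_superset:
  assumes "finite A" "R \<subseteq> A"
  shows "(\<Sum>S\<in>Pow A. (- 1) ^ card (A - S) * of_bool (R \<subseteq> S) :: real) = of_bool (R = A)"
proof -
  have "(\<Sum>S\<in>Pow A. (- 1) ^ card (A - S) * of_bool (R \<subseteq> S) :: real) =
      (\<Sum>S\<in>{S \<in> Pow A. R \<subseteq> S}. (- 1) ^ card (A - S))"
    using assms(1) by (intro sum.mono_neutral_cong_right) auto
  also have "\<dots> = (\<Sum>C\<in>Pow (A - R). (- 1) ^ card C)"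
    by (rule sum.reindex_bij_witness [of _ "\<lambda>C. A - C" "\<lambda>S. A - S"])
       (use assms in \<open>auto simp: double_diff\<close>)
  also have "\<dots> = of_bool (A - R = {})"
    using assms by (intro sum_alternating_Pow) auto
  finally show ?thesis using assms(2) by (auto simp: of_bool_def split: if_splits)
qed

text \<open>Both sides are polynomial functions of \<open>t\<close>, and a real polynomial is
  determined by its function. Entries of \<open>xs\<close> may share an exponent, so the coefficient
  at \<open>n\<close> is a sum over a filtered list.\<close>

lemma coeff_comparison:
  fixes a :: "'b \<Rightarrow> real"
  assumes "\<And>t. (\<Sum>x\<leftarrow>xs. a x * t ^ e x) = b * t ^ n"
  shows "(\<Sum>x\<leftarrow>filter (\<lambda>x. e x = n) xs. a x) = b"
proof -
  define p where "p = (\<Sum>x\<leftarrow>xs. monom (a x) (e x))"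
  have "poly p t = (\<Sum>x\<leftarrow>xs. a x * t ^ e x)" for t
    unfolding p_def by (induction xs) (auto simp: poly_monom)
  then have "poly p = poly (monom b n)"
    using assms by (auto simp: poly_monom)
  then have "p = monom b n"
    by (simp add: poly_eq_poly_eq_iff)
  moreover have "coeff p n = (\<Sum>x\<leftarrow>filter (\<lambda>x. e x = n) xs. a x)"
    unfolding p_def by (induction xs) auto
  ultimately show ?thesis by simp
qed

lemma sum_list_mult_product:
  fixes f :: "'b \<Rightarrow> real"
  shows "(\<Sum>x\<leftarrow>xs. f x) * (\<Sum>y\<leftarrow>ys. g y) = (\<Sum>(x, y)\<leftarrow>List.product xs ys. f x * g y)"
  by (induction xs) (auto simp: algebra_simps sum_list_const_mult comp_def)

lemma finite_slots [simp]: "finite (slots k d)"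
  by (simp add: slots_def)

lemma fst_slots: "s \<in> slots k d \<Longrightarrow> fst s \<in> {1..k}"
  by (auto simp: slots_def)

lemma prod_slots: "prod f (slots k d) = (\<Prod>j=1..k. \<Prod>i=1..d j. f (j, i))"
  by (simp add: slots_def prod.Sigma)

locale subspace_family =
  fixes k :: nat and V :: "nat \<Rightarrow> 'a::real_vector set" and d :: "nat \<Rightarrow> nat"
  assumes subspace_V: "j \<in> {1..k} \<Longrightarrow> subspace (V j)"
begin

lemma subspace_slot: "s \<in> slots k d \<Longrightarrow> subspace (V (fst s))"
  using subspace_V fst_slots by blast

lemma args_upd:
  "x \<in> args k V d \<Longrightarrow> s \<in> slots k d \<Longrightarrow> a \<in> V (fst s) \<Longrightarrow> x(s := a) \<in> args k V d"
  unfolding args_def by (auto simp: PiE_iff extensional_def)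

text \<open>Linearity is applied slot by slot; a choice function \<open>g\<close> records which
  summand is taken in each slot of \<open>S\<close>. The tuple \<open>z\<close> fills the other
  slots and is generalized in the induction.\<close>

lemma multilinear_expand_partial:
  assumes F: "F \<in> multilinear_maps k V d"
    and S: "finite S" "S \<subseteq> slots k d"
    and z: "z \<in> args k V d"
    and T: "\<And>s. s \<in> S \<Longrightarrow> finite (T s)"
    and y: "\<And>s t. s \<in> S \<Longrightarrow> t \<in> T s \<Longrightarrow> y s t \<in> V (fst s)"
  shows "F (\<lambda>s. if s \<in> S then \<Sum>t\<in>T s. c s t *\<^sub>R y s t else z s) =
    (\<Sum>g\<in>Pi\<^sub>E S T. (\<Prod>s\<in>S. c s (g s)) * F (\<lambda>s. if s \<in> S then y s (g s) else z s))"
  using S z T y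
proof (induction S arbitrary: z rule: finite_induct)
  case empty
  then show ?case by simp
next
  case (insert s S)
  let ?a = "\<Sum>t\<in>T s. c s t *\<^sub>R y s t"
  have s: "s \<in> slots k d" using insert.prems by auto
  have a: "?a \<in> V (fst s)"
    by (intro subspace_sum subspace_scale subspace_slot [OF s] insert.prems(4)) simp
  have step: "F (\<lambda>r. if r \<in> S then y r (g r) else (z(s := ?a)) r) =
      (\<Sum>t\<in>T s. c s t * F (\<lambda>r. if r \<in> insert s S then y r ((g(s := t)) r) else z r))"
    if g: "g \<in> Pi\<^sub>E S T" for g
  proof -
    let ?w = "\<lambda>r. if r \<in> S then y r (g r) else z r"
    have w: "?w \<in> args k V d"
      using insert.prems g unfolding args_def by (auto simp: PiE_iff extensional_def)
    have upd: "?w(s := b) = (\<lambda>r. if r \<in> S then y r (g r) else (z(s := b)) r)" for b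
      using insert.hyps by auto
    have upd': "?w(s := y s t) = (\<lambda>r. if r \<in> insert s S then y r ((g(s := t)) r) else z r)" for t
      using insert.hyps by auto
    have lin: "linear_on (V (fst s)) (\<lambda>b. F (?w(s := b)))"
      using F s w unfolding multilinear_maps_def by blast
    have "F (?w(s := ?a)) = (\<Sum>t\<in>T s. c s t *\<^sub>R F (?w(s := y s t)))"
      using insert.prems by (intro linear_on_sum [OF lin subspace_slot [OF s]]) auto
    then show ?thesis
      unfolding upd [symmetric] upd' [symmetric] by simp
  qed
  \<comment> \<open>The sum in slot \<open>s\<close> is moved into the background tuple
    \<open>z\<close>, so that the induction hypothesis expands the slots of \<open>S\<close>
    only.\<close>
  have "F (\<lambda>r. if r \<in> insert s S then \<Sum>t\<in>T r. c r t *\<^sub>R y r t else z r) =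
      F (\<lambda>r. if r \<in> S then \<Sum>t\<in>T r. c r t *\<^sub>R y r t else (z(s := ?a)) r)"
    using insert.hyps by (intro arg_cong [where f = F]) auto
  also have "\<dots> = (\<Sum>g\<in>Pi\<^sub>E S T. (\<Prod>r\<in>S. c r (g r)) *
      F (\<lambda>r. if r \<in> S then y r (g r) else (z(s := ?a)) r))"
    using insert.prems args_upd [OF insert.prems(2) s a] by (intro insert.IH) blast+
  also have "\<dots> = (\<Sum>g\<in>Pi\<^sub>E S T. \<Sum>t\<in>T s. (\<Prod>r\<in>insert s S. c r ((g(s := t)) r)) *
      F (\<lambda>r. if r \<in> insert s S then y r ((g(s := t)) r) else z r))"
  proof (rule sum.cong [OF refl], goal_cases)
    case (1 g)
    have "(\<Prod>r\<in>insert s S. c r ((g(s := t)) r)) = c s t * (\<Prod>r\<in>S. c r (g r))" for t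
    proof -
      have "(\<Prod>r\<in>S. c r ((g(s := t)) r)) = (\<Prod>r\<in>S. c r (g r))"
        using insert.hyps by (intro prod.cong) auto
      then show ?thesis using insert.hyps by simp
    qed
    then show ?case
      unfolding step [OF 1] by (simp add: sum_distrib_left mult_ac)
  qed
  finally show ?case
    unfolding sum_PiE_insert [OF insert.hyps(2)] .
qed

lemma multilinear_expand:
  assumes F: "F \<in> multilinear_maps k V d"
    and T: "\<And>s. s \<in> slots k d \<Longrightarrow> finite (T s)"
    and y: "\<And>s t. s \<in> slots k d \<Longrightarrow> t \<in> T s \<Longrightarrow> y s t \<in> V (fst s)"
  shows "F (\<lambda>s\<in>slots k d. \<Sum>t\<in>T s. c s t *\<^sub>R y s t) =
    (\<Sum>g\<in>Pi\<^sub>E (slots k d) T. (\<Prod>s\<in>slots k d. c s (g s)) * F (\<lambda>s\<in>slots k d. y s (g s)))"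
proof -
  \<comment> \<open>A background tuple for the expansion: zero lies in every subspace, and the value
    off the slots is \<open>undefined\<close>, as \<open>args\<close> demands.\<close>
  have "(\<lambda>s\<in>slots k d. 0) \<in> args k V d"
    using subspace_slot subspace_0 unfolding args_def by auto
  from multilinear_expand_partial [OF F finite_slots subset_refl this T y, where c = c]
  show ?thesis by (simp add: restrict_def cong: if_cong)
qed

lemma multilinear_scale:
  assumes F: "F \<in> multilinear_maps k V d" and x: "x \<in> args k V d"
  shows "F (\<lambda>s\<in>slots k d. c s *\<^sub>R x s) = (\<Prod>s\<in>slots k d. c s) * F x"
proof -
  \<comment> \<open>Each argument is a sum with the single index \<open>()\<close>, so there is only
    one choice function and one term.\<close>
  have "F (\<lambda>s\<in>slots k d. \<Sum>t\<in>{()}. c s *\<^sub>R x s) =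
     (\<Sum>g\<in>Pi\<^sub>E (slots k d) (\<lambda>_. {()}). (\<Prod>s\<in>slots k d. c s) * F (\<lambda>s\<in>slots k d. x s))"
    by (rule multilinear_expand [OF F, of "\<lambda>_. {()}"]) (use x in \<open>auto simp: args_def\<close>)
  moreover have "restrict x (slots k d) = x"
    using x by (simp add: args_def)
  ultimately show ?thesis by (simp add: card_PiE)
qed

section \<open>Restitutions are multi-homogeneous forms\<close>

lemma diag_in_args: "v \<in> vecs k V \<Longrightarrow> (\<lambda>s\<in>slots k d. v (fst s)) \<in> args k V d"
  using fst_slots unfolding vecs_def args_def by auto

lemma vecs_upd:
  "v \<in> vecs k V \<Longrightarrow> j \<in> {1..k} \<Longrightarrow> a \<in> V j \<Longrightarrow> v(j := a) \<in> vecs k V"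
  unfolding vecs_def by (auto simp: PiE_iff extensional_def)

lemma vecs_scale: "v \<in> vecs k V \<Longrightarrow> j \<in> {1..k} \<Longrightarrow> v(j := t *\<^sub>R v j) \<in> vecs k V"
  by (intro vecs_upd) (auto simp: vecs_def intro!: subspace_scale subspace_V)

text \<open>Scaling \<open>v j\<close> scales exactly the \<open>d j\<close> slots of block
  \<open>j\<close>, and each of them releases one factor \<open>t\<close>.\<close>

lemma restitution_homogeneous:
  assumes F: "F \<in> multilinear_maps k V d" and v: "v \<in> vecs k V" and j: "j \<in> {1..k}"
  shows "restitution k V d F (v(j := t *\<^sub>R v j)) = t ^ d j * restitution k V d F v"
proof -
  let ?c = "\<lambda>s. if fst s = j then t else 1"
  have "(\<lambda>s\<in>slots k d. (v(j := t *\<^sub>R v j)) (fst s)) =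
      (\<lambda>s\<in>slots k d. ?c s *\<^sub>R (\<lambda>s\<in>slots k d. v (fst s)) s)"
    by auto
  then have "restitution k V d F (v(j := t *\<^sub>R v j)) =
      (\<Prod>s\<in>slots k d. ?c s) * restitution k V d F v"
    using multilinear_scale [OF F diag_in_args [OF v], of ?c] v vecs_scale [OF v j]
    by (simp add: restitution_def)
  also have "(\<Prod>s\<in>slots k d. ?c s) = (\<Prod>l=1..k. if l = j then t ^ d j else 1)"
    unfolding prod_slots by (intro prod.cong) auto
  also have "\<dots> = t ^ d j"
    using j by simp
  finally show ?thesis .
qed

lemma polynomials_cong:
  assumes "(\<lambda>v\<in>vecs k V. p v) \<in> polynomials k V" "\<And>v. v \<in> vecs k V \<Longrightarrow> p v = q v"
  shows "(\<lambda>v\<in>vecs k V. q v) \<in> polynomials k V"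
  using assms restrict_ext [of "vecs k V" p q] by metis

lemma polynomials_sum:
  assumes "finite I" "\<And>i. i \<in> I \<Longrightarrow> (\<lambda>v\<in>vecs k V. p i v) \<in> polynomials k V"
  shows "(\<lambda>v\<in>vecs k V. \<Sum>i\<in>I. p i v) \<in> polynomials k V"
  using assms
proof (induction I rule: finite_induct)
  case empty
  show ?case unfolding sum.empty by (rule polynomials.const)
next
  case (insert i I)
  then have "(\<lambda>v\<in>vecs k V. (\<lambda>v\<in>vecs k V. p i v) v + (\<lambda>v\<in>vecs k V. \<Sum>i\<in>I. p i v) v)
      \<in> polynomials k V"
    by (intro polynomials.add) auto
  then show ?case
    by (rule polynomials_cong) (use insert.hyps in simp)
qed

lemma polynomials_prod:
  assumes "finite I" "\<And>i. i \<in> I \<Longrightarrow> (\<lambda>v\<in>vecs k V. p i v) \<in> polynomials k V"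
  shows "(\<lambda>v\<in>vecs k V. \<Prod>i\<in>I. p i v) \<in> polynomials k V"
  using assms
proof (induction I rule: finite_induct)
  case empty
  show ?case unfolding prod.empty by (rule polynomials.const)
next
  case (insert i I)
  then have "(\<lambda>v\<in>vecs k V. (\<lambda>v\<in>vecs k V. p i v) v * (\<lambda>v\<in>vecs k V. \<Prod>i\<in>I. p i v) v)
      \<in> polynomials k V"
    by (intro polynomials.mult) auto
  then show ?case
    by (rule polynomials_cong) (use insert.hyps in simp)
qed

text \<open>Expanding each \<open>v j\<close> in a finite basis gives a finite sum, over choices of
  basis vectors for the slots, of products of coordinates with constant values of \<open>F\<close>.
  Finite dimension enters here.\<close>

lemma restitution_polynomial:
  assumes F: "F \<in> multilinear_maps k V d"
    and fin: "\<And>j. j \<in> {1..k} \<Longrightarrow> fin_dim_subspace (V j)"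
  shows "restitution k V d F \<in> polynomials k V"
proof -
  \<comment> \<open>\<open>fin_dim_subspace\<close> supplies a finite spanning set; a maximal
    independent subset of it is a basis.\<close>
  have "\<exists>B. finite B \<and> independent B \<and> span B = V j" if j: "j \<in> {1..k}" for j
  proof -
    obtain C where C: "finite C" "span C = V j"
      using fin [OF j] unfolding fin_dim_subspace_def by blast
    obtain B where B: "B \<subseteq> C" "independent B" "C \<subseteq> span B"
      using maximal_independent_subset [of C] by blast
    have "span B = span C"
      using B span_superset [of C] by (subst span_eq) blast
    then show ?thesis
      using B C finite_subset [of B C] by auto
  qed
  then obtain B where B: "\<And>j. j \<in> {1..k} \<Longrightarrow> finite (B j)"
      "\<And>j. j \<in> {1..k} \<Longrightarrow> independent (B j)" "\<And>j. j \<in> {1..k} \<Longrightarrow> span (B j) = V j"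
    by metis
  let ?T = "\<lambda>s. B (fst s)"
  let ?c = "\<lambda>v s b. representation (B (fst s)) (v (fst s)) b"
  have eq: "F (\<lambda>s\<in>slots k d. v (fst s)) =
    (\<Sum>g\<in>Pi\<^sub>E (slots k d) ?T. (\<Prod>s\<in>slots k d. ?c v s (g s)) * F (\<lambda>s\<in>slots k d. g s))"
    if v: "v \<in> vecs k V" for v
  proof -
    have "(\<Sum>b\<in>?T s. ?c v s b *\<^sub>R b) = v (fst s)" if "s \<in> slots k d" for s
      using that v B fst_slots [OF that] unfolding vecs_def
      by (intro sum_representation_eq) auto
    then have "(\<lambda>s\<in>slots k d. v (fst s)) = (\<lambda>s\<in>slots k d. \<Sum>b\<in>?T s. ?c v s b *\<^sub>R b)"
      by (auto cong: restrict_cong)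
    then have "F (\<lambda>s\<in>slots k d. v (fst s)) = F (\<lambda>s\<in>slots k d. \<Sum>b\<in>?T s. ?c v s b *\<^sub>R b)"
      by simp
    also have "\<dots> = (\<Sum>g\<in>Pi\<^sub>E (slots k d) ?T. (\<Prod>s\<in>slots k d. ?c v s (g s)) * F (\<lambda>s\<in>slots k d. g s))"
      by (rule multilinear_expand [OF F]) (use B(1,3) fst_slots span_base in blast)+
    finally show ?thesis .
  qed
  \<comment> \<open>Coordinates in a basis are linear functionals, hence generators of
    \<open>polynomials k V\<close>.\<close>
  have lin: "(\<lambda>v\<in>vecs k V. ?c v s b) \<in> polynomials k V" if s: "s \<in> slots k d" for s b
  proof (rule polynomials.coord)
    show "fst s \<in> {1..k}" using s by (rule fst_slots)
    then show "linear_on (V (fst s)) (\<lambda>a. representation (B (fst s)) a b)"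
      using B by (auto simp: linear_on_def representation_add representation_scale)
  qed
  have "(\<lambda>v\<in>vecs k V. (\<Prod>s\<in>slots k d. ?c v s (g s)) * F (\<lambda>s\<in>slots k d. g s))
      \<in> polynomials k V" for g
    by (rule polynomials_cong
        [OF polynomials.mult [OF polynomials_prod [OF finite_slots lin] polynomials.const]]) auto
  then have "(\<lambda>v\<in>vecs k V. \<Sum>g\<in>Pi\<^sub>E (slots k d) ?T.
      (\<Prod>s\<in>slots k d. ?c v s (g s)) * F (\<lambda>s\<in>slots k d. g s)) \<in> polynomials k V"
    by (intro polynomials_sum finite_PiE finite_slots) (use B(1) fst_slots in blast)+
  then show ?thesis
    unfolding restitution_def by (rule polynomials_cong) (rule eq [symmetric])
qed

lemma restitution_form:
  assumes "F \<in> multilinear_maps k V d"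
    and "\<And>j. j \<in> {1..k} \<Longrightarrow> fin_dim_subspace (V j)"
  shows "restitution k V d F \<in> multi_homogeneous_forms k V d"
  using restitution_polynomial [OF assms] restitution_homogeneous [OF assms(1)]
  unfolding multi_homogeneous_forms_def by auto

end

section \<open>Polarization identity\<close>

context subspace_family
begin

lemma block_update_in_args:
  assumes "j \<in> {1..k}" "\<pi> permutes {1..d j}" "x \<in> args k V d"
  shows "(\<lambda>(l, i). if l = j then x (l, \<pi> i) else x (l, i)) \<in> args k V d"
  unfolding args_def
proof (rule PiE_I)
  fix s assume "s \<in> slots k d"
  then show "(case s of (l, i) \<Rightarrow> if l = j then x (l, \<pi> i) else x (l, i)) \<in> V (fst s)"
    using assms(3) permutes_in_image [OF assms(2), of "snd s"]
    by (cases s) (force simp: args_def slots_def PiE_iff)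
next
  fix s assume "s \<notin> slots k d"
  then show "(case s of (l, i) \<Rightarrow> if l = j then x (l, \<pi> i) else x (l, i)) = undefined"
    using assms(1,3) permutes_not_in [OF assms(2), of "snd s"]
    by (cases s) (auto simp: args_def slots_def PiE_iff extensional_def)
qed

text \<open>The product of the symmetric groups of the blocks, realized inside the permutations of
  all slots so that it acts on tuples by composition.\<close>

definition block_perms :: "(nat \<times> nat \<Rightarrow> nat \<times> nat) set" where
  "block_perms = {\<pi>. \<pi> permutes slots k d \<and> (\<forall>s. fst (\<pi> s) = fst s)}"

lemma finite_block_perms: "finite block_perms"
  unfolding block_perms_def by (rule finite_subset [OF _ finite_permutations [OF finite_slots]]) auto

lemma block_permsD:
  assumes "\<pi> \<in> block_perms"
  shows "\<pi> permutes slots k d" "fst (\<pi> s) = fst s"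
  using assms by (auto simp: block_perms_def simp del: split_paired_All)

lemma block_perms_inv:
  assumes "\<pi> \<in> block_perms"
  shows "inv_into UNIV \<pi> \<in> block_perms"
proof -
  note \<pi> = block_permsD [OF assms]
  have "fst (inv_into UNIV \<pi> s) = fst s" for s
    using \<pi>(2) [of "inv_into UNIV \<pi> s"] by (simp add: permutes_inverses [OF \<pi>(1)])
  then show ?thesis
    using permutes_inv [OF \<pi>(1)] unfolding block_perms_def by blast
qed

lemma block_perms_comp: "\<pi> \<in> block_perms \<Longrightarrow> \<tau> \<in> block_perms \<Longrightarrow> \<pi> \<circ> \<tau> \<in> block_perms"
  unfolding block_perms_def by (auto simp: permutes_compose simp del: split_paired_All)

lemma args_comp:
  assumes \<pi>: "\<pi> \<in> block_perms" and x: "x \<in> args k V d"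
  shows "x \<circ> \<pi> \<in> args k V d"
  unfolding args_def
proof (rule PiE_I)
  fix s assume "s \<in> slots k d"
  then show "(x \<circ> \<pi>) s \<in> V (fst s)"
    using PiE_mem [OF x [unfolded args_def], of "\<pi> s"] block_permsD [OF \<pi>]
    by (simp add: permutes_in_image)
next
  fix s assume "s \<notin> slots k d"
  then show "(x \<circ> \<pi>) s = undefined"
    using PiE_arb [OF x [unfolded args_def]] permutes_not_in [OF block_permsD(1) [OF \<pi>]] by simp
qed

text \<open>A permutation preserving the blocks is applied one block at a time.\<close>

lemma multi_symmetric_block_perm:
  assumes sym: "multi_symmetric k V d F" and \<pi>: "\<pi> \<in> block_perms" and x: "x \<in> args k V d"
  shows "F (x \<circ> \<pi>) = F x"
proof -
  note perm = block_permsD(1) [OF \<pi>] and fst_\<pi> = block_permsD(2) [OF \<pi>]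
  have pair: "\<pi> (j, i) = (j, snd (\<pi> (j, i)))" for j i
    using fst_\<pi> [of "(j, i)"] by (metis fst_conv prod.collapse)
  have block: "(\<lambda>i. snd (\<pi> (j, i))) permutes {1..d j}" if j: "j \<in> {1..k}" for j
  proof (rule bij_imp_permutes)
    let ?f = "\<lambda>i. snd (\<pi> (j, i))"
    show "?f i = i" if "i \<notin> {1..d j}" for i
      using permutes_not_in [OF perm, of "(j, i)"] that by (auto simp: slots_def)
    have "inj ?f"
    proof (rule injI)
      fix i i' assume "?f i = ?f i'"
      then have "\<pi> (j, i) = \<pi> (j, i')" using pair by metis
      then show "i = i'" using permutes_inj [OF perm] by (auto dest: injD)
    qed
    then have "inj_on ?f {1..d j}" by (rule inj_on_subset) simp
    moreover have "?f i \<in> {1..d j}" if "i \<in> {1..d j}" for i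
    proof -
      have "\<pi> (j, i) \<in> slots k d"
        using permutes_in_image [OF perm, of "(j, i)"] that j by (simp add: slots_def)
      then show ?thesis using pair [of j i] by (auto simp: slots_def)
    qed
    then have "?f ` {1..d j} \<subseteq> {1..d j}" by blast
    ultimately show "bij_betw ?f {1..d j} {1..d j}"
      by (simp add: bij_betw_def endo_inj_surj)
  qed
  \<comment> \<open>\<open>y m\<close> has \<open>\<pi>\<close> applied in the first
    \<open>m\<close> blocks only. It interpolates between \<open>x\<close> and
    \<open>x \<circ> \<pi>\<close>, and consecutive tuples differ by a permutation of one
    block.\<close>
  define y where "y = (\<lambda>m. \<lambda>s. if fst s \<le> m then x (\<pi> s) else x s)"
  have y: "y m \<in> args k V d" for m
    using x args_comp [OF \<pi> x] unfolding y_def args_def by (auto simp: PiE_iff extensional_def)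
  have "F (y m) = F x" if "m \<le> k" for m
    using that
  proof (induction m)
    case 0
    \<comment> \<open>Blocks are numbered from 1, so \<open>fst s \<le> 0\<close> happens only off
      the slots, where \<open>\<pi>\<close> is the identity.\<close>
    have "y 0 s = x s" for s
      unfolding y_def using permutes_not_in [OF perm, of s] fst_slots [of s] by force
    then show ?case by presburger
  next
    case (Suc m)
    have "y (Suc m) = (\<lambda>(l, i). if l = Suc m then y m (l, snd (\<pi> (Suc m, i))) else y m (l, i))"
    proof (rule ext)
      fix s :: "nat \<times> nat"
      obtain l i where s: "s = (l, i)" by (cases s)
      show "y (Suc m) s = (case s of (l, i) \<Rightarrow>
          if l = Suc m then y m (l, snd (\<pi> (Suc m, i))) else y m (l, i))"
        unfolding s y_def by (cases "l = Suc m") (auto simp: fst_\<pi> simp flip: pair)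
    qed
    moreover have "F \<dots> = F (y m)"
      using sym block [of "Suc m"] y [of m] Suc.prems unfolding multi_symmetric_def by force
    ultimately show ?case using Suc by simp
  qed
  moreover have "y k = x \<circ> \<pi>"
  proof (rule ext)
    show "y k s = (x \<circ> \<pi>) s" for s
      unfolding y_def using permutes_not_in [OF perm, of s] fst_slots [of s k d] by (cases "s \<in> slots k d") auto
  qed
  ultimately show ?thesis by (metis order_refl)
qed

text \<open>The argument for \<open>S\<close> is, in block \<open>j\<close>, the sum of those
  \<open>x t\<close> of the block with \<open>t\<close> in \<open>S\<close>. The surjective choice
  functions correspond to the block permutations, so the factor on the right is the product of the
  factorials of the \<open>d j\<close>; it stays a cardinality because only its being nonzero is
  used later.\<close>

lemma polarization_identity:
  assumes F: "F \<in> multi_symmetric_maps k V d" and x: "x \<in> args k V d"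
  shows "(\<Sum>S\<in>Pow (slots k d). (- 1) ^ card (slots k d - S) * restitution k V d F
      (\<lambda>j\<in>{1..k}. \<Sum>t\<in>{t \<in> slots k d. fst t = j}. of_bool (t \<in> S) *\<^sub>R x t)) =
    real (card {g \<in> (\<Pi>\<^sub>E s\<in>slots k d. {t \<in> slots k d. fst t = fst s}). g ` slots k d = slots k d}) * F x"
proof -
  let ?I = "slots k d"
  let ?T = "\<lambda>s. {t \<in> ?I. fst t = fst s}"
  let ?w = "\<lambda>S. \<lambda>j\<in>{1..k}. \<Sum>t\<in>{t \<in> ?I. fst t = j}. of_bool (t \<in> S) *\<^sub>R x t"
  let ?L = "\<Sum>S\<in>Pow ?I. (- 1) ^ card (?I - S) * restitution k V d F (?w S)"
  let ?surj = "{g \<in> Pi\<^sub>E ?I ?T. g ` ?I = ?I}"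
  have multi: "F \<in> multilinear_maps k V d" and sym: "multi_symmetric k V d F"
    using F by (auto simp: multi_symmetric_maps_def)
  have xV: "x t \<in> V (fst t)" if "t \<in> ?I" for t
    using x that by (auto simp: args_def)
  have fin: "finite (Pi\<^sub>E ?I ?T)" by (intro finite_PiE) auto
  \<comment> \<open>The coefficients are 0 or 1, so their product along \<open>g\<close> indicates
    whether \<open>g\<close> takes all its values in \<open>S\<close>.\<close>
  have prod_of_bool: "(\<Prod>s\<in>?I. of_bool (g s \<in> S) :: real) = of_bool (g ` ?I \<subseteq> S)"
    for g :: "_ \<Rightarrow> nat \<times> nat" and S
    by (cases "g ` ?I \<subseteq> S") (auto intro!: prod.neutral prod_zero)
  have exp: "restitution k V d F (?w S) =
      (\<Sum>g\<in>Pi\<^sub>E ?I ?T. of_bool (g ` ?I \<subseteq> S) * F (\<lambda>s\<in>?I. x (g s)))" for S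
  proof -
    have w: "?w S \<in> vecs k V"
      unfolding vecs_def using xV
      by (auto intro!: subspace_sum subspace_scale subspace_V simp del: of_bool_eq scaleR_eq_0_iff) 
    have "(\<lambda>s\<in>?I. ?w S (fst s)) = (\<lambda>s\<in>?I. \<Sum>t\<in>?T s. of_bool (t \<in> S) *\<^sub>R x t)"
      using fst_slots by (intro restrict_ext) auto
    then have "restitution k V d F (?w S) = F (\<lambda>s\<in>?I. \<Sum>t\<in>?T s. of_bool (t \<in> S) *\<^sub>R x t)"
      unfolding restitution_def using w by simp
    also have "\<dots> = (\<Sum>g\<in>Pi\<^sub>E ?I ?T. (\<Prod>s\<in>?I. of_bool (g s \<in> S)) * F (\<lambda>s\<in>?I. x (g s)))"
    proof (rule multilinear_expand [OF multi])
      show "x t \<in> V (fst s)" if "t \<in> ?T s" for s t using xV [of t] that by auto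
    qed simp
    finally show ?thesis by (simp only: prod_of_bool)
  qed
  have "?L = (\<Sum>S\<in>Pow ?I. \<Sum>g\<in>Pi\<^sub>E ?I ?T.
      (- 1) ^ card (?I - S) * of_bool (g ` ?I \<subseteq> S) * F (\<lambda>s\<in>?I. x (g s)))"
    unfolding exp sum_distrib_left by (simp only: mult.assoc)
  \<comment> \<open>After the exchange, each \<open>g\<close> carries an alternating sum over the
    supersets of its image.\<close>
  also have "\<dots> = (\<Sum>g\<in>Pi\<^sub>E ?I ?T.
      (\<Sum>S\<in>Pow ?I. (- 1) ^ card (?I - S) * of_bool (g ` ?I \<subseteq> S)) * F (\<lambda>s\<in>?I. x (g s)))"
    unfolding sum_distrib_right by (rule sum.swap)
  also have "\<dots> = (\<Sum>g\<in>Pi\<^sub>E ?I ?T. of_bool (g ` ?I = ?I) * F (\<lambda>s\<in>?I. x (g s)))"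
  proof (rule sum.cong [OF refl])
    fix g assume "g \<in> Pi\<^sub>E ?I ?T"
    then have "g ` ?I \<subseteq> ?I" by blast
    then show "(\<Sum>S\<in>Pow ?I. (- 1) ^ card (?I - S) * of_bool (g ` ?I \<subseteq> S)) * F (\<lambda>s\<in>?I. x (g s)) =
        of_bool (g ` ?I = ?I) * F (\<lambda>s\<in>?I. x (g s))"
      by (simp only: sum_alternating_superset [OF finite_slots])
  qed
  also have "\<dots> = (\<Sum>g\<in>?surj. F (\<lambda>s\<in>?I. x (g s)))"
    by (rule sum.mono_neutral_cong_right [OF fin]) auto
  also have "\<dots> = (\<Sum>g\<in>?surj. F x)"
  proof (rule sum.cong [OF refl])
    fix g assume g: "g \<in> ?surj"
    \<comment> \<open>\<open>g\<close> is \<open>undefined\<close> off the slots, so it is extended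
      there by the identity to become a permutation; surjectivity on a finite set gives
      injectivity.\<close>
    let ?\<pi> = "\<lambda>s. if s \<in> ?I then g s else s"
    have "inj_on g ?I" using g by (intro eq_card_imp_inj_on) auto
    then have "bij_betw ?\<pi> ?I ?I"
      using g by (auto simp: bij_betw_def inj_on_def)
    then have "?\<pi> permutes ?I" by (rule bij_imp_permutes) simp
    moreover have "fst (?\<pi> s) = fst s" for s using g by auto
    ultimately have "?\<pi> \<in> block_perms" by (simp add: block_perms_def)
    moreover have "(\<lambda>s\<in>?I. x (g s)) = x \<circ> ?\<pi>"
      using x unfolding args_def by (auto simp: PiE_iff extensional_def)
    ultimately show "F (\<lambda>s\<in>?I. x (g s)) = F x"
      using multi_symmetric_block_perm [OF sym _ x] by simp
  qed
  also have "\<dots> = real (card ?surj) * F x" by simp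
  finally show ?thesis .
qed

text \<open>The left side of \<open>polarization_identity\<close> depends on the map only through
  its restitution, and the factor on the right is nonzero because the identity is a surjective
  choice function.\<close>

lemma restitution_inj:
  assumes F: "F \<in> multi_symmetric_maps k V d" and H: "H \<in> multi_symmetric_maps k V d"
    and eq: "restitution k V d F = restitution k V d H"
  shows "F = H"
proof (rule extensionalityI)
  show "F \<in> extensional (args k V d)" "H \<in> extensional (args k V d)"
    using F H by (auto simp: multi_symmetric_maps_def multilinear_maps_def)
  fix x assume x: "x \<in> args k V d"
  let ?surj = "{g \<in> (\<Pi>\<^sub>E s\<in>slots k d. {t \<in> slots k d. fst t = fst s}). g ` slots k d = slots k d}"
  have "(\<lambda>s\<in>slots k d. s) \<in> ?surj" by auto
  moreover have "finite ?surj" by (intro finite_subset [OF Collect_subset] finite_PiE) auto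
  ultimately have "card ?surj \<noteq> 0" using card_gt_0_iff [of ?surj] by blast
  then show "F x = H x"
    using polarization_identity [OF F x] polarization_identity [OF H x] eq by simp
qed

end

section \<open>Forms as restitutions\<close>

text \<open>A list \<open>A j\<close> of linear functionals on each \<open>V j\<close> represents the monomial
  \<open>\<Prod>\<^sub>j \<Prod>\<^bsub>\<phi> \<in> A j\<^esub> \<phi>(v\<^sub>j)\<close> of multi-degree \<open>j \<mapsto> length (A j)\<close>.\<close>

definition monomial_fun :: "nat \<Rightarrow> (nat \<Rightarrow> ('a \<Rightarrow> real) list) \<Rightarrow> (nat \<Rightarrow> 'a) \<Rightarrow> real" where
  "monomial_fun k A v = (\<Prod>j=1..k. \<Prod>\<phi>\<leftarrow>A j. \<phi> (v j))"

definition linear_factors ::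
  "nat \<Rightarrow> (nat \<Rightarrow> 'a::real_vector set) \<Rightarrow> (nat \<Rightarrow> ('a \<Rightarrow> real) list) \<Rightarrow> bool" where
  "linear_factors k V A \<longleftrightarrow> (\<forall>j\<in>{1..k}. \<forall>\<phi>\<in>set (A j). linear_on (V j) \<phi>)"

lemma monomial_fun_append:
  "monomial_fun k (\<lambda>j. A j @ B j) v = monomial_fun k A v * monomial_fun k B v"
  by (simp add: monomial_fun_def prod.distrib)

lemma monomial_fun_scale:
  assumes A: "linear_factors k V A" and v: "v \<in> vecs k V" and j: "j \<in> {1..k}"
  shows "monomial_fun k A (v(j := t *\<^sub>R v j)) = t ^ length (A j) * monomial_fun k A v"
proof -
  have vj: "v j \<in> V j" using v j by (auto simp: vecs_def)
  have "(\<Prod>\<phi>\<leftarrow>L. \<phi> (t *\<^sub>R v j)) = t ^ length L * (\<Prod>\<phi>\<leftarrow>L. \<phi> (v j))"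
    if "\<forall>\<phi>\<in>set L. linear_on (V j) \<phi>" for L :: "('a \<Rightarrow> real) list"
    using that vj by (induction L) (auto simp: linear_on_def)
  then have eq: "(\<Prod>\<phi>\<leftarrow>A j. \<phi> (t *\<^sub>R v j)) = t ^ length (A j) * (\<Prod>\<phi>\<leftarrow>A j. \<phi> (v j))"
    using A j unfolding linear_factors_def by blast
  show ?thesis
    unfolding monomial_fun_def prod.remove [OF finite_atLeastAtMost j] using eq
    by (simp cong: prod.cong_simp)
qed

text \<open>Linear combinations of monomials contain the generators and are closed under sums and
  products. They are held as lists with repetitions allowed, so that concatenation gives the
  sum.\<close>

lemma polynomial_expansion:
  assumes "p \<in> polynomials k V"
  shows "\<exists>Ls. (\<forall>(c, A)\<in>set Ls. linear_factors k V A) \<and>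
    (\<forall>v\<in>vecs k V. p v = (\<Sum>(c, A)\<leftarrow>Ls. c * monomial_fun k A v))"
  using assms
proof (induction p rule: polynomials.induct)
  case (const c)
  show ?case
    by (rule exI [of _ "[(c, \<lambda>_. [])]"]) (simp add: monomial_fun_def linear_factors_def)
next
  case (coord j \<phi>)
  have "monomial_fun k ((\<lambda>_. [])(j := [\<phi>])) v = \<phi> (v j)" for v
  proof -
    have "monomial_fun k ((\<lambda>_. [])(j := [\<phi>])) v = (\<Prod>i=1..k. if i = j then \<phi> (v j) else 1)"
      unfolding monomial_fun_def by (intro prod.cong) auto
    then show ?thesis using coord by simp
  qed
  then show ?case
    using coord by (intro exI [of _ "[(1, (\<lambda>_. [])(j := [\<phi>]))]"]) (simp add: linear_factors_def)
next
  case (add p q)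
  then obtain Ls Ms where "\<forall>(c, A)\<in>set Ls. linear_factors k V A"
    "\<forall>(c, A)\<in>set Ms. linear_factors k V A"
    "\<forall>v\<in>vecs k V. p v = (\<Sum>(c, A)\<leftarrow>Ls. c * monomial_fun k A v)"
    "\<forall>v\<in>vecs k V. q v = (\<Sum>(c, A)\<leftarrow>Ms. c * monomial_fun k A v)" by blast
  then show ?case
    by (intro exI [of _ "Ls @ Ms"]) auto
next
  case (mult p q)
  then obtain Ls Ms where L: "\<forall>(c, A)\<in>set Ls. linear_factors k V A"
    "\<forall>(c, A)\<in>set Ms. linear_factors k V A"
    and pq: "\<forall>v\<in>vecs k V. p v = (\<Sum>(c, A)\<leftarrow>Ls. c * monomial_fun k A v)"
    "\<forall>v\<in>vecs k V. q v = (\<Sum>(c, A)\<leftarrow>Ms. c * monomial_fun k A v)" by blast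
  \<comment> \<open>Appending factor lists multiplies monomials; there is one term for each
    pair.\<close>
  let ?N = "map (\<lambda>((c, A), (b, B)). (c * b, \<lambda>j. A j @ B j)) (List.product Ls Ms)"
  have "\<forall>(c, A)\<in>set ?N. linear_factors k V A"
    using L by (fastforce simp: linear_factors_def)
  moreover have "(\<Sum>(c, A)\<leftarrow>Ls. c * monomial_fun k A v) * (\<Sum>(c, A)\<leftarrow>Ms. c * monomial_fun k A v) =
      (\<Sum>(c, A)\<leftarrow>?N. c * monomial_fun k A v)" for v
    unfolding sum_list_mult_product map_map
    by (intro arg_cong [where f = sum_list] map_cong refl)
       (auto simp: monomial_fun_append)
  ultimately show ?case
    using pq by (intro exI [of _ ?N]) simp
qed

context subspace_family
begin

text \<open>In an arbitrary expansion the terms of wrong degree in \<open>v j\<close> add up to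
  zero, so they can be discarded, one index \<open>j\<close> at a time.\<close>

lemma multi_homogeneous_expansion:
  assumes f: "f \<in> multi_homogeneous_forms k V d"
  shows "\<exists>Ls. (\<forall>(c, A)\<in>set Ls. linear_factors k V A \<and> (\<forall>j\<in>{1..k}. length (A j) = d j)) \<and>
    (\<forall>v\<in>vecs k V. f v = (\<Sum>(c, A)\<leftarrow>Ls. c * monomial_fun k A v))"
proof -
  \<comment> \<open>\<open>J\<close> collects the indices whose degree is already right; the
    induction ends at \<open>{1..k}\<close>.\<close>
  have "\<exists>Ls. (\<forall>(c, A)\<in>set Ls. linear_factors k V A \<and> (\<forall>j\<in>J. length (A j) = d j)) \<and>
    (\<forall>v\<in>vecs k V. f v = (\<Sum>(c, A)\<leftarrow>Ls. c * monomial_fun k A v))"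
    if "finite J" "J \<subseteq> {1..k}" for J
    using that
  proof (induction J rule: finite_induct)
    case empty
    have "f \<in> polynomials k V" using f by (simp add: multi_homogeneous_forms_def)
    then show ?case using polynomial_expansion by fastforce
  next
    case (insert j J)
    then obtain Ls where
      Ls: "\<forall>(c, A)\<in>set Ls. linear_factors k V A \<and> (\<forall>j\<in>J. length (A j) = d j)" and
      eq: "\<forall>v\<in>vecs k V. f v = (\<Sum>(c, A)\<leftarrow>Ls. c * monomial_fun k A v)" by auto
    have j: "j \<in> {1..k}" using insert.prems by simp
    let ?Ms = "filter (\<lambda>x. length (snd x j) = d j) Ls"
    have "f v = (\<Sum>(c, A)\<leftarrow>?Ms. c * monomial_fun k A v)" if v: "v \<in> vecs k V" for v
    proof -
      \<comment> \<open>For fixed \<open>v\<close>, scaling \<open>v j\<close> by \<open>t\<close>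
        multiplies the form and each monomial by a power of \<open>t\<close>, so coefficients at
        \<open>t ^ d j\<close> can be compared.\<close>
      have "(\<Sum>x\<leftarrow>Ls. (fst x * monomial_fun k (snd x) v) * t ^ length (snd x j)) = f v * t ^ d j" for t
      proof -
        have "v(j := t *\<^sub>R v j) \<in> vecs k V" by (rule vecs_scale [OF v j])
        then have "f (v(j := t *\<^sub>R v j)) = (\<Sum>(c, A)\<leftarrow>Ls. c * monomial_fun k A (v(j := t *\<^sub>R v j)))"
          using eq by blast
        also have "\<dots> = (\<Sum>x\<leftarrow>Ls. (fst x * monomial_fun k (snd x) v) * t ^ length (snd x j))"
          using Ls monomial_fun_scale [OF _ v j]
          by (intro arg_cong [where f = sum_list] map_cong refl) auto
        also have "f (v(j := t *\<^sub>R v j)) = t ^ d j * f v"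
          using f v j by (simp add: multi_homogeneous_forms_def)
        finally show ?thesis by (simp only: mult.commute)
      qed
      from coeff_comparison [OF this] show ?thesis
        by (simp add: case_prod_beta')
    qed
    moreover have "\<forall>(c, A)\<in>set ?Ms. linear_factors k V A \<and> (\<forall>j\<in>insert j J. length (A j) = d j)"
      using Ls by auto
    ultimately show ?case by blast
  qed
  then show ?thesis by simp
qed

text \<open>Slot \<open>s\<close> enters exactly one factor; the other factors are constant in
  \<open>a\<close>.\<close>

lemma multilinear_prod:
  fixes \<psi> :: "nat \<times> nat \<Rightarrow> 'a \<Rightarrow> real"
  assumes "\<And>s. s \<in> slots k d \<Longrightarrow> linear_on (V (fst s)) (\<psi> s)" and s: "s \<in> slots k d"
  shows "linear_on (V (fst s)) (\<lambda>a. \<Prod>r\<in>slots k d. \<psi> r ((x(s := a)) r))"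
proof -
  have "(\<Prod>r\<in>slots k d. \<psi> r ((x(s := a)) r)) = (\<Prod>r\<in>slots k d - {s}. \<psi> r (x r)) * \<psi> s a" for a
    unfolding prod.remove [OF finite_slots s] by (simp add: mult.commute cong: prod.cong_simp)
  then show ?thesis
    using linear_on_mult [OF assms(1) [OF s]] by simp
qed

text \<open>A monomial of multi-degree \<open>d\<close> has as many functionals on
  \<open>V j\<close> as block \<open>j\<close> has slots. Giving each slot its own functional yields
  a multilinear product that becomes the monomial on the diagonal. Symmetry is arranged
  afterwards.\<close>

lemma multilinear_of_form:
  assumes f: "f \<in> multi_homogeneous_forms k V d"
  obtains M where "M \<in> multilinear_maps k V d" "\<And>v. v \<in> vecs k V \<Longrightarrow> restitution k V d M v = f v"
proof -
  obtain Ls where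
    Ls: "\<And>c A. (c, A) \<in> set Ls \<Longrightarrow> linear_factors k V A"
      "\<And>c A j. (c, A) \<in> set Ls \<Longrightarrow> j \<in> {1..k} \<Longrightarrow> length (A j) = d j" and
    eq: "\<And>v. v \<in> vecs k V \<Longrightarrow> f v = (\<Sum>(c, A)\<leftarrow>Ls. c * monomial_fun k A v)"
    using multi_homogeneous_expansion [OF f] by fast
  \<comment> \<open>Slots count from 1 and list positions from 0, hence the shift.\<close>
  let ?\<psi> = "\<lambda>A s. A (fst s) ! (snd s - 1)"
  let ?M = "\<lambda>x\<in>args k V d. \<Sum>y\<leftarrow>Ls. fst y * (\<Prod>s\<in>slots k d. ?\<psi> (snd y) s (x s))"
  have "?M \<in> multilinear_maps k V d"
    unfolding multilinear_maps_def
  proof (intro CollectI conjI ballI)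
    fix s x assume s: "s \<in> slots k d" and x: "x \<in> args k V d"
    have lin: "linear_on (V (fst s)) (?\<psi> A s)" if "(c, A) \<in> set Ls" "s \<in> slots k d" for c A s
    proof -
      have "fst s \<in> {1..k}" using fst_slots that(2) .
      moreover have "snd s - 1 < length (A (fst s))"
        using Ls(2) [OF that(1)] that(2) by (auto simp: slots_def)
      ultimately show ?thesis
        using Ls(1) [OF that(1)] unfolding linear_factors_def by simp
    qed
    have "linear_on (V (fst s))
        (\<lambda>a. \<Sum>y\<leftarrow>Ls. fst y * (\<Prod>r\<in>slots k d. ?\<psi> (snd y) r ((x(s := a)) r)))"
      by (intro linear_on_sum_list linear_on_mult multilinear_prod [OF _ s])
         (use lin in \<open>force\<close>)
    then show "linear_on (V (fst s)) (\<lambda>a. ?M (x(s := a)))"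
      by (subst linear_on_cong [OF subspace_slot [OF s]]) (auto simp: args_upd [OF x s])
  qed simp
  moreover have "restitution k V d ?M v = f v" if v: "v \<in> vecs k V" for v
  proof -
    have "(\<Prod>s\<in>slots k d. ?\<psi> A s ((\<lambda>s\<in>slots k d. v (fst s)) s)) = monomial_fun k A v"
      if A: "(c, A) \<in> set Ls" for c A
    proof -
      have "(\<Prod>s\<in>slots k d. ?\<psi> A s ((\<lambda>s\<in>slots k d. v (fst s)) s)) =
          (\<Prod>s\<in>slots k d. ?\<psi> A s (v (fst s)))" by (intro prod.cong) auto
      also have "\<dots> = (\<Prod>j=1..k. \<Prod>i=1..d j. (A j ! (i - 1)) (v j))"
        by (simp add: prod_slots)
      also have "\<dots> = monomial_fun k A v"
        unfolding monomial_fun_def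
      proof (rule prod.cong [OF refl])
        fix j assume "j \<in> {1..k}"
        then have len: "length (A j) = d j" by (rule Ls(2) [OF A])
        have "(\<Prod>i=1..d j. (A j ! (i - 1)) (v j)) = (\<Prod>i<d j. (A j ! i) (v j))"
          by (simp add: prod.atLeast1_atMost_eq)
        also have "\<dots> = (\<Prod>\<phi>\<leftarrow>A j. \<phi> (v j))"
          by (simp add: prod.list_conv_set_nth len atLeast0LessThan)
        finally show "(\<Prod>i=1..d j. (A j ! (i - 1)) (v j)) = (\<Prod>\<phi>\<leftarrow>A j. \<phi> (v j))" .
      qed
      finally show ?thesis .
    qed
    then have "(\<Sum>y\<leftarrow>Ls. fst y * (\<Prod>s\<in>slots k d. ?\<psi> (snd y) s ((\<lambda>s\<in>slots k d. v (fst s)) s))) =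
        (\<Sum>(c, A)\<leftarrow>Ls. c * monomial_fun k A v)"
      by (intro arg_cong [where f = sum_list] map_cong refl) (auto simp del: restrict_apply)
    then show ?thesis
      using v diag_in_args [OF v] eq [OF v] by (simp add: restitution_def)
  qed
  ultimately show ?thesis by (rule that)
qed

section \<open>Averaging over the block permutations\<close>

definition symmetrization :: "((nat \<times> nat \<Rightarrow> 'a) \<Rightarrow> real) \<Rightarrow> (nat \<times> nat \<Rightarrow> 'a) \<Rightarrow> real" where
  "symmetrization M = (\<lambda>x\<in>args k V d. (1 / card block_perms) * (\<Sum>\<pi>\<in>block_perms. M (x \<circ> \<pi>)))"

lemma card_block_perms: "card block_perms > 0"
proof -
  have "id \<in> block_perms" by (simp add: block_perms_def permutes_id)
  then show ?thesis using finite_block_perms card_gt_0_iff by blast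
qed

lemma symmetrization_multilinear:
  assumes M: "M \<in> multilinear_maps k V d"
  shows "symmetrization M \<in> multilinear_maps k V d"
  unfolding multilinear_maps_def
proof (intro CollectI conjI ballI)
  show "symmetrization M \<in> extensional (args k V d)" by (simp add: symmetrization_def)
  fix s x assume s: "s \<in> slots k d" and x: "x \<in> args k V d"
  have lin: "linear_on (V (fst s)) (\<lambda>a. M (x(s := a) \<circ> \<pi>))" if \<pi>: "\<pi> \<in> block_perms" for \<pi>
  proof -
    note perm = block_permsD(1) [OF \<pi>]
    let ?s = "inv_into UNIV \<pi> s"
    \<comment> \<open>Updating slot \<open>s\<close> before composing with \<open>\<pi>\<close>
      amounts to updating slot \<open>?s\<close> afterwards; \<open>?s\<close> lies in the same
      block, hence has the same space.\<close>
    have "x(s := a) \<circ> \<pi> = (x \<circ> \<pi>)(?s := a)" for a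
      using permutes_inverses [OF perm] by (auto simp: fun_eq_iff)
    moreover have "fst ?s = fst s" by (rule block_permsD(2) [OF block_perms_inv [OF \<pi>]])
    moreover have "?s \<in> slots k d"
      using permutes_in_image [OF permutes_inv [OF perm]] s by simp
    ultimately show ?thesis
      using M args_comp [OF \<pi> x] unfolding multilinear_maps_def by fastforce
  qed
  have "linear_on (V (fst s)) (\<lambda>a. (1 / card block_perms) * (\<Sum>\<pi>\<in>block_perms. M (x(s := a) \<circ> \<pi>)))"
    by (intro linear_on_mult linear_on_sum_fun lin)
  then show "linear_on (V (fst s)) (\<lambda>a. symmetrization M (x(s := a)))"
    unfolding symmetrization_def
    by (subst linear_on_cong [OF subspace_slot [OF s]]) (auto simp: args_upd [OF x s])
qed

lemma symmetrization_symmetric: "multi_symmetric k V d (symmetrization M)"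
  unfolding multi_symmetric_def
proof (intro ballI allI impI)
  fix j \<pi> x assume j: "j \<in> {1..k}" and \<pi>: "\<pi> permutes {1..d j}" and x: "x \<in> args k V d"
  \<comment> \<open>\<open>\<tau>\<close> lifts a permutation of \<open>{1..d j}\<close> to the
    slots, moving only block \<open>j\<close>.\<close>
  define \<tau> where "\<tau> = (\<lambda>\<pi> (l, i :: nat). if l = j then (l, \<pi> i :: nat) else (l, i))"
  have slots: "\<tau> \<sigma> s \<in> slots k d" if "\<sigma> permutes {1..d j}" "s \<in> slots k d" for \<sigma> s
    using that(2) permutes_in_image [OF that(1), of "snd s"]
    by (cases s) (auto simp: \<tau>_def slots_def)
  have inverse: "\<tau> (inv_into UNIV \<pi>) (\<tau> \<pi> s) = s" "\<tau> \<pi> (\<tau> (inv_into UNIV \<pi>) s) = s" for s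
    by (cases s, simp add: \<tau>_def permutes_inverses [OF \<pi>])+
  have "\<tau> \<pi> permutes slots k d"
  proof (rule bij_imp_permutes)
    show "bij_betw (\<tau> \<pi>) (slots k d) (slots k d)"
      by (rule bij_betw_byWitness [of _ "\<tau> (inv_into UNIV \<pi>)"])
         (use slots inverse \<pi> permutes_inv in blast)+
    fix s assume "s \<notin> slots k d"
    then show "\<tau> \<pi> s = s"
      using j permutes_not_in [OF \<pi>, of "snd s"] by (cases s) (auto simp: \<tau>_def slots_def)
  qed
  moreover have "fst (\<tau> \<pi> s) = fst s" for s
    by (cases s) (simp add: \<tau>_def)
  ultimately have \<tau>: "\<tau> \<pi> \<in> block_perms" unfolding block_perms_def by blast
  have x\<tau>: "(\<lambda>(l, i). if l = j then x (l, \<pi> i) else x (l, i)) = x \<circ> \<tau> \<pi>"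
    by (simp add: \<tau>_def fun_eq_iff)
  \<comment> \<open>Left translation by \<open>\<tau> \<pi>\<close> permutes the group of block
    permutations.\<close>
  have "(\<Sum>\<sigma>\<in>block_perms. M (x \<circ> \<tau> \<pi> \<circ> \<sigma>)) = (\<Sum>\<sigma>\<in>block_perms. M (x \<circ> \<sigma>))"
  proof (rule sum.reindex_bij_witness
      [of _ "\<lambda>\<sigma>. inv_into UNIV (\<tau> \<pi>) \<circ> \<sigma>" "\<lambda>\<sigma>. \<tau> \<pi> \<circ> \<sigma>"])
    fix \<sigma> assume \<sigma>: "\<sigma> \<in> block_perms"
    note inv = permutes_inv_o [OF block_permsD(1) [OF \<tau>]]
    show "inv_into UNIV (\<tau> \<pi>) \<circ> (\<tau> \<pi> \<circ> \<sigma>) = \<sigma>" "\<tau> \<pi> \<circ> (inv_into UNIV (\<tau> \<pi>) \<circ> \<sigma>) = \<sigma>"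
      unfolding o_assoc inv by simp_all
    show "\<tau> \<pi> \<circ> \<sigma> \<in> block_perms" "inv_into UNIV (\<tau> \<pi>) \<circ> \<sigma> \<in> block_perms"
      by (intro block_perms_comp block_perms_inv \<tau> \<sigma>)+
  qed (simp add: o_assoc)
  then show "symmetrization M (\<lambda>(l, i). if l = j then x (l, \<pi> i) else x (l, i)) = symmetrization M x"
    unfolding x\<tau> symmetrization_def using x args_comp [OF \<tau> x] by simp
qed

text \<open>A diagonal tuple is constant on blocks, so all summands coincide, and dividing by the
  group order returns the value of \<open>M\<close>.\<close>

lemma restitution_symmetrization:
  assumes v: "v \<in> vecs k V"
  shows "restitution k V d (symmetrization M) v = restitution k V d M v"
proof -
  let ?x = "\<lambda>s\<in>slots k d. v (fst s)"
  have "?x \<circ> \<pi> = ?x" if \<pi>: "\<pi> \<in> block_perms" for \<pi>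
    using permutes_in_image [OF block_permsD(1) [OF \<pi>]] block_permsD(2) [OF \<pi>]
    by (simp add: fun_eq_iff restrict_def del: split_paired_All)
  then have "(\<Sum>\<pi>\<in>block_perms. M (?x \<circ> \<pi>)) = card block_perms * M ?x" by simp
  then show ?thesis
    using v diag_in_args [OF v] card_block_perms
    by (simp add: restitution_def symmetrization_def)
qed

lemma restitution_surj:
  assumes f: "f \<in> multi_homogeneous_forms k V d"
  shows "\<exists>F\<in>multi_symmetric_maps k V d. restitution k V d F = f"
proof -
  obtain M where M: "M \<in> multilinear_maps k V d"
    "\<And>v. v \<in> vecs k V \<Longrightarrow> restitution k V d M v = f v"
    using multilinear_of_form [OF f] by blast
  have "f \<in> polynomials k V" using f by (simp add: multi_homogeneous_forms_def)
  \<comment> \<open>Every rule of \<open>polynomials\<close> yields a restricted function, so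
    agreement on \<open>vecs k V\<close> gives equality of functions.\<close>
  then have "f \<in> extensional (vecs k V)" by cases auto
  then have "restitution k V d (symmetrization M) = f"
    using restitution_symmetrization M(2)
    by (intro extensionalityI [of _ "vecs k V"]) (auto simp: restitution_def)
  then show ?thesis
    using symmetrization_multilinear [OF M(1)] symmetrization_symmetric
    by (auto simp: multi_symmetric_maps_def)
qed

end

section \<open>Group action\<close>

lemma fin_dim_repD:
  assumes "fin_dim_rep G U \<sigma>" "g \<in> carrier G"
  shows "subspace U" "linear_on U (\<sigma> g)" "x \<in> U \<Longrightarrow> \<sigma> g x \<in> U"
  using assms group_action.element_image [of G U \<sigma> g x]
  unfolding fin_dim_rep_def fin_dim_subspace_def by auto

lemma bij_betw_restrict_bij:
  assumes bij: "bij_betw r A B" and "A' \<subseteq> A" "B' \<subseteq> B"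
    and iff: "\<And>x. x \<in> A \<Longrightarrow> r x \<in> B' \<longleftrightarrow> x \<in> A'"
  shows "bij_betw r A' B'"
  using assms unfolding bij_betw_def by (auto intro: inj_on_subset)

locale rep_family = subspace_family k V d + group G
  for G :: "('g, 'm) monoid_scheme" and k and V :: "nat \<Rightarrow> 'a::real_vector set" and d +
  fixes \<rho> :: "nat \<Rightarrow> 'g \<Rightarrow> 'a \<Rightarrow> 'a"
  assumes rep: "j \<in> {1..k} \<Longrightarrow> fin_dim_rep G (V j) (\<rho> j)"
begin

abbreviation act_vecs :: "'g \<Rightarrow> (nat \<Rightarrow> 'a) \<Rightarrow> nat \<Rightarrow> 'a" where
  "act_vecs \<equiv> diag_act {1..k} \<rho>"

abbreviation act_args :: "'g \<Rightarrow> (nat \<times> nat \<Rightarrow> 'a) \<Rightarrow> nat \<times> nat \<Rightarrow> 'a" where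
  "act_args \<equiv> diag_act (slots k d) (\<lambda>s. \<rho> (fst s))"

lemma act_vecs_closed: "g \<in> carrier G \<Longrightarrow> v \<in> vecs k V \<Longrightarrow> act_vecs g v \<in> vecs k V"
  unfolding vecs_def diag_act_def by (intro restrict_PiE_iff [THEN iffD2] ballI fin_dim_repD(3) [OF rep]) auto

lemma act_args_closed: "g \<in> carrier G \<Longrightarrow> x \<in> args k V d \<Longrightarrow> act_args g x \<in> args k V d"
  unfolding args_def diag_act_def
  by (intro restrict_PiE_iff [THEN iffD2] ballI fin_dim_repD(3) [OF rep [OF fst_slots]]) auto

text \<open>Copying \<open>v j\<close> into all slots of block \<open>j\<close> commutes with the
  action, since each slot carries the representation of its block.\<close>

lemma restitution_fun_act:
  assumes g: "g \<in> carrier G"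
  shows "restitution k V d (fun_act G (args k V d) act_args g F) =
    fun_act G (vecs k V) act_vecs g (restitution k V d F)"
proof (rule extensionalityI [of _ "vecs k V"])
  fix v assume v: "v \<in> vecs k V"
  have "act_args (inv\<^bsub>G\<^esub> g) (\<lambda>s\<in>slots k d. v (fst s)) = (\<lambda>s\<in>slots k d. act_vecs (inv\<^bsub>G\<^esub> g) v (fst s))"
    using fst_slots by (intro ext) (auto simp: diag_act_def)
  then show "restitution k V d (fun_act G (args k V d) act_args g F) v =
    fun_act G (vecs k V) act_vecs g (restitution k V d F) v"
    using v g diag_in_args [OF v] act_vecs_closed [of "inv\<^bsub>G\<^esub> g" v]
    by (simp add: restitution_def fun_act_def)
qed (auto simp: restitution_def fun_act_def)

text \<open>In one slot, the translated map is \<open>F\<close> with the other arguments moved by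
  the inverse of \<open>g\<close>, composed with the linear action of that inverse on the space of
  the slot.\<close>

lemma fun_act_multilinear:
  assumes F: "F \<in> multilinear_maps k V d" and g: "g \<in> carrier G"
  shows "fun_act G (args k V d) act_args g F \<in> multilinear_maps k V d"
  unfolding multilinear_maps_def
proof (intro CollectI conjI ballI)
  fix s x assume s: "s \<in> slots k d" and x: "x \<in> args k V d"
  have g': "inv\<^bsub>G\<^esub> g \<in> carrier G" using g by simp
  note rep' = fin_dim_repD [OF rep [OF fst_slots [OF s]] g']
  have "linear_on (V (fst s)) (\<lambda>a. F ((act_args (inv\<^bsub>G\<^esub> g) x)(s := a)))"
    using F s act_args_closed [OF g' x] unfolding multilinear_maps_def by blast
  then have "linear_on (V (fst s)) (\<lambda>a. F ((act_args (inv\<^bsub>G\<^esub> g) x)(s := \<rho> (fst s) (inv\<^bsub>G\<^esub> g) a)))"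
    using rep'(2,3) by (simp add: linear_on_def)
  moreover have "act_args (inv\<^bsub>G\<^esub> g) (x(s := a)) = (act_args (inv\<^bsub>G\<^esub> g) x)(s := \<rho> (fst s) (inv\<^bsub>G\<^esub> g) a)" for a
    using s by (auto simp: diag_act_def fun_eq_iff)
  ultimately show "linear_on (V (fst s)) (\<lambda>a. fun_act G (args k V d) act_args g F (x(s := a)))"
    by (subst linear_on_cong [OF subspace_slot [OF s]]) (auto simp: args_upd [OF x s] fun_act_def)
qed (simp add: fun_act_def)

text \<open>All slots of a block are acted on in the same way, so the action commutes with permuting
  them.\<close>

lemma fun_act_symmetric:
  assumes F: "multi_symmetric k V d F" and g: "g \<in> carrier G"
  shows "multi_symmetric k V d (fun_act G (args k V d) act_args g F)"
  unfolding multi_symmetric_def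
proof (intro ballI allI impI)
  fix j \<pi> x assume j: "j \<in> {1..k}" and \<pi>: "\<pi> permutes {1..d j}" and x: "x \<in> args k V d"
  let ?p = "\<lambda>x (l, i). if l = j then x (l, \<pi> i) else x (l, i)"
  let ?y = "act_args (inv\<^bsub>G\<^esub> g) x"
  have "act_args (inv\<^bsub>G\<^esub> g) (?p x) s = ?p ?y s" for s
    using permutes_in_image [OF \<pi>, of "snd s"] by (cases s) (auto simp: diag_act_def slots_def)
  then have "act_args (inv\<^bsub>G\<^esub> g) (?p x) = ?p ?y" by (rule ext)
  moreover have "F (?p ?y) = F ?y"
    using F j \<pi> act_args_closed [OF inv_closed [OF g] x] unfolding multi_symmetric_def by blast
  ultimately show "fun_act G (args k V d) act_args g F (?p x) = fun_act G (args k V d) act_args g F x"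
    using x block_update_in_args [OF j \<pi> x] by (simp add: fun_act_def)
qed

section \<open>Bijections on all and on invariant elements\<close>

lemma restitution_bij:
  "bij_betw (restitution k V d) (multi_symmetric_maps k V d) (multi_homogeneous_forms k V d)"
proof (rule bij_betw_imageI)
  show "inj_on (restitution k V d) (multi_symmetric_maps k V d)"
    by (rule inj_onI) (rule restitution_inj)
  have "restitution k V d F \<in> multi_homogeneous_forms k V d" if "F \<in> multi_symmetric_maps k V d" for F
    using that restitution_form rep unfolding multi_symmetric_maps_def fin_dim_rep_def by blast
  then show "restitution k V d ` multi_symmetric_maps k V d = multi_homogeneous_forms k V d"
    using restitution_surj by blast
qed

text \<open>Equivariance gives one direction. For the other, the translate of \<open>F\<close> is
  again multi-symmetric with the same restitution as \<open>F\<close>, so injectivity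
  applies.\<close>

lemma invariant_restitution_iff:
  assumes F: "F \<in> multi_symmetric_maps k V d"
  shows "invariant G (vecs k V) act_vecs (restitution k V d F) \<longleftrightarrow>
    invariant G (args k V d) act_args F"
proof -
  have "fun_act G (vecs k V) act_vecs g (restitution k V d F) = restitution k V d F \<longleftrightarrow>
      fun_act G (args k V d) act_args g F = F" if g: "g \<in> carrier G" for g
  proof -
    have gF: "fun_act G (args k V d) act_args g F \<in> multi_symmetric_maps k V d"
      using F fun_act_multilinear fun_act_symmetric g by (auto simp: multi_symmetric_maps_def)
    show ?thesis
      unfolding restitution_fun_act [OF g, symmetric]
      by (rule iffI [OF restitution_inj [OF gF F]]) simp_all
  qed
  then show ?thesis by (simp add: invariant_def)
qed

lemma restitution_invariant_bij:
  "bij_betw (restitution k V d) (invariant_multi_symmetric_maps G k V \<rho> d) (invariant_forms G k V \<rho> d)"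
  by (rule bij_betw_restrict_bij [OF restitution_bij])
     (use bij_betw_apply [OF restitution_bij] invariant_restitution_iff
       in \<open>auto simp: invariant_forms_def invariant_multi_symmetric_maps_def\<close>)

text \<open>Injectivity of restitution makes the description in \<open>polarization\<close>
  unique.\<close>

lemma polarization_restitution:
  assumes "F \<in> multi_symmetric_maps k V d"
  shows "polarization k V d (restitution k V d F) = F"
  unfolding polarization_def using assms by (intro the_equality) (auto intro: restitution_inj)

section \<open>Compatibility with linear combinations\<close>

lemma restitution_lin_comb:
  "restitution k V d (lin_comb (args k V d) a F b H) =
    lin_comb (vecs k V) a (restitution k V d F) b (restitution k V d H)"
  unfolding restitution_def lin_comb_def using diag_in_args by (intro restrict_ext) auto

lemma lin_comb_multilinear:
  assumes "F \<in> multilinear_maps k V d" "H \<in> multilinear_maps k V d"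
  shows "lin_comb (args k V d) a F b H \<in> multilinear_maps k V d"
  unfolding multilinear_maps_def
proof (intro CollectI conjI ballI)
  fix s x assume s: "s \<in> slots k d" and x: "x \<in> args k V d"
  have "linear_on (V (fst s)) (\<lambda>c. F (x(s := c)))" "linear_on (V (fst s)) (\<lambda>c. H (x(s := c)))"
    using assms s x unfolding multilinear_maps_def by blast+
  then have "linear_on (V (fst s)) (\<lambda>c. a * F (x(s := c)) + b * H (x(s := c)))"
    by (simp add: linear_on_def algebra_simps)
  then show "linear_on (V (fst s)) (\<lambda>c. lin_comb (args k V d) a F b H (x(s := c)))"
    by (subst linear_on_cong [OF subspace_slot [OF s]]) (auto simp: args_upd [OF x s] lin_comb_def)
qed (simp add: lin_comb_def)

lemma lin_comb_symmetric:
  assumes "multi_symmetric k V d F" "multi_symmetric k V d H"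
  shows "multi_symmetric k V d (lin_comb (args k V d) a F b H)"
  using assms block_update_in_args unfolding multi_symmetric_def lin_comb_def by simp

lemma lin_comb_invariant:
  assumes "invariant G (args k V d) act_args F" "invariant G (args k V d) act_args H"
  shows "invariant G (args k V d) act_args (lin_comb (args k V d) a F b H)"
  unfolding invariant_def
proof
  fix g assume g: "g \<in> carrier G"
  have *: "F (act_args (inv\<^bsub>G\<^esub> g) x) = F x" "H (act_args (inv\<^bsub>G\<^esub> g) x) = H x" if "x \<in> args k V d" for x
    using assms g that unfolding invariant_def fun_act_def by (metis restrict_apply')+
  show "fun_act G (args k V d) act_args g (lin_comb (args k V d) a F b H) =
      lin_comb (args k V d) a F b H"
    unfolding fun_act_def lin_comb_def using * g act_args_closed by (intro restrict_ext) auto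
qed

lemma lin_comb_invariant_maps:
  assumes "F \<in> invariant_multi_symmetric_maps G k V \<rho> d" "H \<in> invariant_multi_symmetric_maps G k V \<rho> d"
  shows "lin_comb (args k V d) a F b H \<in> invariant_multi_symmetric_maps G k V \<rho> d"
  using assms lin_comb_multilinear lin_comb_symmetric lin_comb_invariant
  unfolding invariant_multi_symmetric_maps_def multi_symmetric_maps_def by blast

end

text \<open>To identify the two sides means that restitution and polarization are mutually inverse
  linear bijections between them. The first conjunct justifies the \<open>THE\<close> in
  \<open>polarization\<close>.\<close>

theorem theorem1:
  fixes G :: "('g, 'm) monoid_scheme"
    and k :: nat
    and V :: "nat \<Rightarrow> 'a::real_vector set"
    and \<rho> :: "nat \<Rightarrow> 'g \<Rightarrow> 'a \<Rightarrow> 'a"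
    and d :: "nat \<Rightarrow> nat"
  assumes "group G"
    and "\<And>j. j \<in> {1..k} \<Longrightarrow> fin_dim_rep G (V j) (\<rho> j)"
  defines "Forms \<equiv> invariant_forms G k V \<rho> d"
    and "Maps \<equiv> invariant_multi_symmetric_maps G k V \<rho> d"
  shows "(\<forall>f\<in>Forms. \<exists>!F. F \<in> multi_symmetric_maps k V d \<and> restitution k V d F = f) \<and>
    bij_betw (polarization k V d) Forms Maps \<and>
    bij_betw (restitution k V d) Maps Forms \<and>
    (\<forall>f\<in>Forms. restitution k V d (polarization k V d f) = f) \<and>
    (\<forall>F\<in>Maps. polarization k V d (restitution k V d F) = F) \<and>
    (\<forall>f\<in>Forms. \<forall>g\<in>Forms. \<forall>a b.
       lin_comb (vecs k V) a f b g \<in> Forms \<and>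
       polarization k V d (lin_comb (vecs k V) a f b g) =
         lin_comb (args k V d) a (polarization k V d f) b (polarization k V d g)) \<and>
    (\<forall>F\<in>Maps. \<forall>H\<in>Maps. \<forall>a b.
       lin_comb (args k V d) a F b H \<in> Maps \<and>
       restitution k V d (lin_comb (args k V d) a F b H) =
         lin_comb (vecs k V) a (restitution k V d F) b (restitution k V d H))"
proof -
  interpret group G by fact
  interpret rep_family G k V d \<rho>
    by unfold_locales (use assms(2) in \<open>auto simp: fin_dim_rep_def fin_dim_subspace_def\<close>)
  have sub: "Maps \<subseteq> multi_symmetric_maps k V d"
    unfolding Maps_def invariant_multi_symmetric_maps_def by blast
  have bij: "bij_betw (restitution k V d) Maps Forms"
    unfolding Maps_def Forms_def by (rule restitution_invariant_bij)
  \<comment> \<open>Invariant forms are from here on written as restitutions of invariant maps,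
    which transfers facts about maps to forms.\<close>
  then have img: "Forms = restitution k V d ` Maps"
    by (simp add: bij_betw_def)
  have PR: "polarization k V d (restitution k V d F) = F" if "F \<in> Maps" for F
    using polarization_restitution that sub by blast
  have comb: "lin_comb (args k V d) a F b H \<in> Maps" if "F \<in> Maps" "H \<in> Maps" for F H a b
    using lin_comb_invariant_maps that unfolding Maps_def by blast
  \<comment> \<open>Existence comes from an invariant map, while uniqueness is injectivity on all
    multi-symmetric maps.\<close>
  have "\<exists>!F. F \<in> multi_symmetric_maps k V d \<and> restitution k V d F = f" if "f \<in> Forms" for f
    using that sub restitution_inj unfolding img by blast
  moreover have "bij_betw (polarization k V d) Forms Maps"
    by (rule bij_betw_byWitness [of _ "restitution k V d"]) (auto simp: img PR)
  moreover have "restitution k V d (polarization k V d f) = f" if "f \<in> Forms" for f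
    using that PR unfolding img by auto
  \<comment> \<open>Polarization inherits linearity from its inverse: a combination of two
    restitutions is the restitution of the combined maps.\<close>
  moreover have "lin_comb (vecs k V) a f b g \<in> Forms \<and>
       polarization k V d (lin_comb (vecs k V) a f b g) =
         lin_comb (args k V d) a (polarization k V d f) b (polarization k V d g)"
    if "f \<in> Forms" "g \<in> Forms" for f g a b
    using that comb PR unfolding img by (auto simp flip: restitution_lin_comb)
  ultimately show ?thesis
    using bij PR comb restitution_lin_comb by simp
qed

end
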